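(* Let $p\ge 3$ be a prime. Then $\mathcal{I}(\mathbb{Z}_{p^2},2)=p^3$. Moreover, every integral point set in $\mathbb{Z}_{p^2}^2$ of cardinality $p^3$ is isomorphic to one of the following sets: (a) $\{(i,jp)\mid i,j\in\mathbb{Z}_{p^2}\}$; (b) (only if $-1$ is a square modulo $p$) $\{(i,i\omega+jp)\mid i,j\in\mathbb{Z}_{p^2}\}$, where $\omega\in\mathbb{Z}_{p^2}$ satisfies $\omega^2=-1$; (c) (only if $-1$ is a square modulo $p$) the set of all $(x,y)\in\mathbb{Z}_{p^2}^2$ whose reduction modulo $p$ lies in $\{(s,\omega_p s)\mid s\in\square_{\mathbb{Z}_p}\}\cup\{(s,-\omega_p s)\mid s\in\square_{\mathbb{Z}_p}\}$, where $\omega_p\in\mathbb{Z}_p$ satisfies $\omega_p^2=-1$.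
   Context: $\mathbb{Z}_n=\mathbb{Z}/n\mathbb{Z}$. For a commutative ring $\mathcal{R}$ with $1$ put $\square_{\mathcal{R}}=\{t^2\mid t\in\mathcal{R}\}$. For $u,v\in\mathcal{R}^2$ let $d^2(u,v)=(u_1-v_1)^2+(u_2-v_2)^2$; $u,v$ are at integral distance if $d^2(u,v)\in\square_{\mathcal{R}}$, and then $\Delta(u,v)=1$; otherwise $\Delta(u,v)=0$. An integral point set in $\mathcal{R}^2$ is a set of points pairwise at integral distance; $\mathcal{I}(\mathcal{R},2)$ is the maximum cardinality of such a set. An automorphism of $\mathcal{R}^2$ with respect to $\Delta$ is a bijection $\varphi$ of $\mathcal{R}^2$ with $\Delta(\varphi(u),\varphi(v))=\Delta(u,v)$ for all $u,v$ and such that for all $u,w\in\mathcal{R}^2$ there are $u',w'\in\mathcal{R}^2$ with $\{\varphi(u+tw)\mid t\in\mathcal{R}\}=\{u'+tw'\mid t\in\mathcal{R}\}$. Two point sets are isomorphic if some such automorphism maps one onto the other. *)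

theory Defs
  imports "HOL-Number_Theory.Number_Theory"
begin

definition ring_squares :: "('a, 'b) ring_scheme \<Rightarrow> 'a set" where
  "ring_squares R = {t \<otimes>\<^bsub>R\<^esub> t | t. t \<in> carrier R}"

definition plane :: "('a, 'b) ring_scheme \<Rightarrow> ('a \<times> 'a) set" where
  "plane R = carrier R \<times> carrier R"

definition sq_dist :: "('a, 'b) ring_scheme \<Rightarrow> 'a \<times> 'a \<Rightarrow> 'a \<times> 'a \<Rightarrow> 'a" where
  "sq_dist R u v =
     (fst u \<ominus>\<^bsub>R\<^esub> fst v) [^]\<^bsub>R\<^esub> (2::nat) \<oplus>\<^bsub>R\<^esub> (snd u \<ominus>\<^bsub>R\<^esub> snd v) [^]\<^bsub>R\<^esub> (2::nat)"

definition integral_distance :: "('a, 'b) ring_scheme \<Rightarrow> 'a \<times> 'a \<Rightarrow> 'a \<times> 'a \<Rightarrow> bool" where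
  "integral_distance R u v \<longleftrightarrow> sq_dist R u v \<in> ring_squares R"

definition Delta :: "('a, 'b) ring_scheme \<Rightarrow> 'a \<times> 'a \<Rightarrow> 'a \<times> 'a \<Rightarrow> nat" where
  "Delta R u v = (if integral_distance R u v then 1 else 0)"

definition integral_point_set :: "('a, 'b) ring_scheme \<Rightarrow> ('a \<times> 'a) set \<Rightarrow> bool" where
  "integral_point_set R S \<longleftrightarrow>
     S \<subseteq> plane R \<and> (\<forall>u\<in>S. \<forall>v\<in>S. integral_distance R u v)"

(* Meaningful for finite carriers only: there the set of cardinalities is finite and,
   because of the empty point set, nonempty. *)
definition max_integral_card :: "('a, 'b) ring_scheme \<Rightarrow> nat" where
  "max_integral_card R = Max {card S | S. integral_point_set R S}"

(* The direction w may be any vector, including zero or a nonzero non-unimodular one. *)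
definition plane_line :: "('a, 'b) ring_scheme \<Rightarrow> 'a \<times> 'a \<Rightarrow> 'a \<times> 'a \<Rightarrow> ('a \<times> 'a) set" where
  "plane_line R u w =
     {(fst u \<oplus>\<^bsub>R\<^esub> t \<otimes>\<^bsub>R\<^esub> fst w, snd u \<oplus>\<^bsub>R\<^esub> t \<otimes>\<^bsub>R\<^esub> snd w) | t. t \<in> carrier R}"

definition plane_automorphism ::
    "('a, 'b) ring_scheme \<Rightarrow> ('a \<times> 'a \<Rightarrow> 'a \<times> 'a) \<Rightarrow> bool" where
  "plane_automorphism R \<phi> \<longleftrightarrow>
     bij_betw \<phi> (plane R) (plane R) \<and>
     (\<forall>u\<in>plane R. \<forall>v\<in>plane R. Delta R (\<phi> u) (\<phi> v) = Delta R u v) \<and>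
     (\<forall>u\<in>plane R. \<forall>w\<in>plane R. \<exists>u'\<in>plane R. \<exists>w'\<in>plane R.
        \<phi> ` plane_line R u w = plane_line R u' w')"

definition isomorphic_point_sets ::
    "('a, 'b) ring_scheme \<Rightarrow> ('a \<times> 'a) set \<Rightarrow> ('a \<times> 'a) set \<Rightarrow> bool" where
  "isomorphic_point_sets R S T \<longleftrightarrow> (\<exists>\<phi>. plane_automorphism R \<phi> \<and> \<phi> ` S = T)"

abbreviation Zmod :: "nat \<Rightarrow> int ring" where
  "Zmod n \<equiv> residue_ring (int n)"

definition minus_one_roots :: "('a, 'b) ring_scheme \<Rightarrow> 'a set" where
  "minus_one_roots R =
     {\<omega> \<in> carrier R. \<omega> [^]\<^bsub>R\<^esub> (2::nat) = \<ominus>\<^bsub>R\<^esub> \<one>\<^bsub>R\<^esub>}"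

(* Elements of Zmod n are the integers 0, ..., n - 1; in particular int p is the class of p
   in Zmod (p^2), and "_ mod int p" is the reduction map from Zmod (p^2) to Zmod p. *)

definition set_a :: "nat \<Rightarrow> (int \<times> int) set" where
  "set_a p =
     {(i, j \<otimes>\<^bsub>Zmod (p^2)\<^esub> int p) | i j. i \<in> carrier (Zmod (p^2)) \<and> j \<in> carrier (Zmod (p^2))}"

definition set_b :: "nat \<Rightarrow> int \<Rightarrow> (int \<times> int) set" where
  "set_b p \<omega> =
     {(i, i \<otimes>\<^bsub>Zmod (p^2)\<^esub> \<omega> \<oplus>\<^bsub>Zmod (p^2)\<^esub> j \<otimes>\<^bsub>Zmod (p^2)\<^esub> int p) | i j.
        i \<in> carrier (Zmod (p^2)) \<and> j \<in> carrier (Zmod (p^2))}"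

definition set_c :: "nat \<Rightarrow> int \<Rightarrow> (int \<times> int) set" where
  "set_c p \<omega>\<^sub>p =
     {(x, y) \<in> plane (Zmod (p^2)). (x mod int p, y mod int p) \<in>
        {(s, \<omega>\<^sub>p \<otimes>\<^bsub>Zmod p\<^esub> s) | s. s \<in> ring_squares (Zmod p)} \<union>
        {(s, (\<ominus>\<^bsub>Zmod p\<^esub> \<omega>\<^sub>p) \<otimes>\<^bsub>Zmod p\<^esub> s) | s. s \<in> ring_squares (Zmod p)}}"

end

theory Submission
  imports Defs "HOL-Computational_Algebra.Polynomial"
begin

text \<open>
  Choose \<open>t\<close> with \<open>1 + t\<^sup>2\<close> a non-square modulo \<open>p\<close>. Then no two points of an integral set \<open>S\<close> which differ
  modulo \<open>p\<close> have difference proportional to \<open>(t, 1)\<close> modulo \<open>p\<close>, so the residue of a point is determined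
  by \<open>x - t y mod p\<close>; hence there are at most \<open>p\<close> residues and at most \<open>p\<^sup>3\<close> points. If equality holds, \<open>S\<close>
  is a union of \<open>p\<close> full residue classes, and varying the representatives excludes pairs of
  classes at isotropic difference. (Sets as in (b) and (c) contain such pairs, so only (a) occurs.)
  The residues form the graph of a function \<open>y = f (x - t y)\<close> modulo \<open>p\<close>, all of whose directions have non-zero
  square norm. There are at most \<open>(p + 1) / 2\<close> such directions, by rational parametrisation of a
  conic, so \<open>f\<close> is affine by the theorem of Redei and Megyesi, for which the proof of Lovasz and
  Schrijver is used: if \<open>m\<close> is not a slope, then \<open>f x - m x\<close> is a permutation, its low power sums vanish,
  and comparing coefficients in \<open>m\<close> makes all sums of \<open>f(x)\<^sup>j x\<^sup>i\<close> with \<open>0 < j\<close>, \<open>i + j \<le> (p - 1) / 2\<close> vanish. The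
  line through two points of \<open>S\<close> is finally mapped to the horizontal axis by a similarity whose
  factor is a square unit.
\<close>

section \<open>Power sums and polynomials modulo a prime\<close>

lemma not_dvd_diff_residues:
  fixes a b n :: int
  assumes "a \<in> {0..<n}" "b \<in> {0..<n}" "a \<noteq> b"
  shows "\<not> n dvd a - b"
  using assms by (auto simp: mod_eq_dvd_iff[symmetric])

lemma poly_eq_sum_le:
  fixes F :: "'a::comm_semiring_1 poly"
  assumes "degree F \<le> n"
  shows "poly F x = (\<Sum>i\<le>n. coeff F i * x ^ i)"
  unfolding poly_altdef using assms
  by (intro sum.mono_neutral_left) (auto simp: coeff_eq_0)

text \<open>Telescoping (x + 1)^(k+1) - x^(k+1) over x < p gives p^(k+1); the binomial theorem
  writes the same sum as k + 1 times the k-th power sum plus multiples of lower ones. The lower ones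
  vanish by induction, and k + 1 < p is a unit.\<close>

lemma dvd_power_sum:
  fixes p k :: nat
  assumes "prime p" "k < p - 1"
  shows "int p dvd (\<Sum>x<p. int x ^ k)"
  using assms(2)
proof (induction k rule: less_induct)
  case (less k)
  have "(\<Sum>x<p. int (Suc x) ^ Suc k - int x ^ Suc k) = int p ^ Suc k"
    by (subst sum_lessThan_telescope) simp
  moreover have "int (Suc x) ^ Suc k - int x ^ Suc k = (\<Sum>j\<le>k. int (Suc k choose j) * int x ^ j)" for x
    using binomial_ring[of "int x" 1 "Suc k"] by (simp add: algebra_simps)
  ultimately have "int p ^ Suc k = (\<Sum>x<p. \<Sum>j\<le>k. int (Suc k choose j) * int x ^ j)"
    by simp
  also have "\<dots> = (\<Sum>j\<le>k. int (Suc k choose j) * (\<Sum>x<p. int x ^ j))"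
    by (subst sum.swap) (simp add: sum_distrib_left)
  also have "\<dots> = (\<Sum>j<k. int (Suc k choose j) * (\<Sum>x<p. int x ^ j)) + int (Suc k) * (\<Sum>x<p. int x ^ k)"
    by (simp add: lessThan_Suc_atMost[symmetric])
  finally have eq: "int p ^ Suc k = \<dots>" .
  have "int p dvd (\<Sum>j<k. int (Suc k choose j) * (\<Sum>x<p. int x ^ j))"
    by (rule dvd_sum, rule dvd_mult) (use less in auto)
  moreover have "int p dvd int p ^ Suc k" by simp
  ultimately have "int p dvd int (Suc k) * (\<Sum>x<p. int x ^ k)"
    unfolding eq by (simp add: dvd_add_right_iff)
  moreover have "\<not> int p dvd int (Suc k)"
    using less.prems by (metis Suc_less_eq2 dvd_imp_le int_dvd_int_iff less_diff_conv Suc_eq_plus1 not_le zero_less_Suc)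
  ultimately show ?case
    using assms(1) by (metis prime_dvd_multD prime_nat_int_transfer)
qed

lemma fermat_int:
  fixes p :: nat and a :: int
  assumes "prime p" "\<not> int p dvd a"
  shows "[a ^ (p - 1) = 1] (mod int p)"
proof -
  have p: "p > 0" using assms(1) prime_gt_0_nat by blast
  define b where "b = nat (a mod int p)"
  have b: "int b = a mod int p" using p by (simp add: b_def)
  then have "\<not> p dvd b"
    using assms(2) by (simp add: int_dvd_int_iff[symmetric] dvd_mod_iff)
  then have "[int b ^ (p - 1) = 1] (mod int p)"
    using fermat_theorem[OF assms(1)] by (metis cong_int_iff of_nat_1 of_nat_power)
  moreover have "[a ^ (p - 1) = int b ^ (p - 1)] (mod int p)"
    unfolding b by (intro cong_pow) (simp add: cong_def)
  ultimately show ?thesis by (rule cong_trans[rotated])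
qed

text \<open>By \<open>dvd_power_sum\<close> only the exponent p - 1 survives the summation; by
  Fermat its power sum counts the p - 1 non-zero residues.\<close>

lemma sum_poly_cong_coeff:
  fixes p :: nat and G :: "int poly"
  assumes "prime p" "degree G \<le> p - 1"
  shows "[(\<Sum>x<p. poly G (int x)) = - coeff G (p - 1)] (mod int p)"
proof -
  have p: "p > 1" using assms(1) prime_gt_1_nat by blast
  have top: "[(\<Sum>x<p. int x ^ (p - 1)) = - 1] (mod int p)"
  proof -
    have "(\<Sum>x<p. int x ^ (p - 1)) = (\<Sum>x\<in>{1..<p}. int x ^ (p - 1))"
      using p by (intro sum.mono_neutral_right) (auto simp: zero_power)
    also have "[\<dots> = (\<Sum>x\<in>{1..<p}. 1)] (mod int p)"
      using assms(1) by (intro cong_sum fermat_int) (auto dest: nat_dvd_not_less)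
    also have "(\<Sum>x\<in>{1..<p}. (1::int)) = int p + (- 1)"
      using p by (simp add: of_nat_diff)
    also have "[\<dots> = - 1] (mod int p)" by (simp add: cong_iff_dvd_diff)
    finally show ?thesis .
  qed
  have "poly G (int x) = (\<Sum>i\<le>p - 1. coeff G i * int x ^ i)" for x
    using assms(2) by (rule poly_eq_sum_le)
  then have "(\<Sum>x<p. poly G (int x)) = (\<Sum>i\<le>p - 1. coeff G i * (\<Sum>x<p. int x ^ i))"
    by (simp add: sum_distrib_left) (subst sum.swap, simp)
  also have "\<dots> = (\<Sum>i<p - 1. coeff G i * (\<Sum>x<p. int x ^ i)) + coeff G (p - 1) * (\<Sum>x<p. int x ^ (p - 1))"
    by (simp add: lessThan_Suc_atMost[symmetric])
  also have "[\<dots> = 0 + coeff G (p - 1) * (- 1)] (mod int p)"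
    using dvd_power_sum[OF assms(1)]
    by (intro cong_add cong_mult top) (auto simp: cong_0_iff intro!: dvd_sum)
  finally show ?thesis by simp
qed

text \<open>The root bound over the field of p elements, for integer representatives. Splitting off
  X - a by synthetic division leaves the remainder F(a), a multiple of p, and the quotient keeps all
  other roots.\<close>

lemma dvd_coeff_if_many_roots:
  fixes p :: nat and F :: "int poly"
  assumes "prime p" "A \<subseteq> {0..<int p}" "degree F < card A \<or> F = 0"
    and "\<And>a. a \<in> A \<Longrightarrow> int p dvd poly F a"
  shows "int p dvd coeff F i"
  using assms(2-)
proof (induction "degree F" arbitrary: F A i)
  case 0
  then obtain c where F: "F = [:c:]" by (metis degree_eq_zeroE)
  show ?case
  proof (cases "c = 0")
    case False
    then have "A \<noteq> {}" using 0 F by force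
    then show ?thesis using 0 F by (auto simp: coeff_pCons split: nat.split)
  qed (simp add: F)
next
  case (Suc n)
  have fin: "finite A" using Suc.prems(1) finite_subset by blast
  have "card A > Suc n" using Suc by auto
  then obtain a where a: "a \<in> A" by fastforce
  define Q where "Q = synthetic_div F a"
  have F: "F = [:- a, 1:] * Q + [:poly F a:]"
    using synthetic_div_correct'[of a F] by (simp add: Q_def)
  have degQ: "degree Q = n" using Suc(2) by (simp add: Q_def degree_synthetic_div)
  have "int p dvd poly Q b" if b: "b \<in> A - {a}" for b
  proof -
    have "poly F b = (b - a) * poly Q b + poly F a"
      by (subst F) (simp add: algebra_simps)
    then have "int p dvd (b - a) * poly Q b"
      using Suc.prems(3)[of b] Suc.prems(3)[OF a] b by (simp add: dvd_add_left_iff)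
    moreover have "\<not> int p dvd b - a"
      using b a Suc.prems(1) by (intro not_dvd_diff_residues) auto
    ultimately show ?thesis
      using assms(1) by (metis prime_dvd_multD prime_nat_int_transfer)
  qed
  then have dQ: "int p dvd coeff Q j" for j
    using degQ Suc.prems(1) \<open>card A > Suc n\<close> a fin
    by (intro Suc(1)[of Q "A - {a}" j]) auto
  have "coeff F i = - a * coeff Q i + (if i = 0 then 0 else coeff Q (i - 1)) + coeff [:poly F a:] i"
    by (subst F) (simp add: coeff_pCons split: nat.split)
  then show ?case
    using dQ Suc.prems(3)[OF a] by (auto simp: coeff_pCons split: nat.split)
qed

text \<open>Interpolation without denominators: by Fermat, 1 - (X - a)^(p-1) is 1 at a and 0 at all
  other residues.\<close>

lemma ex_poly_cong:
  fixes p :: nat and f :: "nat \<Rightarrow> int"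
  assumes "prime p"
  shows "\<exists>F::int poly. degree F \<le> p - 1 \<and> (\<forall>x<p. [poly F (int x) = f x] (mod int p))"
proof -
  define F where "F = (\<Sum>a<p. smult (f a) (1 - [:- int a, 1:] ^ (p - 1)))"
  have "degree F \<le> p - 1"
    unfolding F_def
    by (intro degree_sum_le order.trans[OF degree_smult_le] degree_diff_le)
       (auto simp: degree_power_eq)
  moreover have "[poly F (int x) = f x] (mod int p)" if x: "x < p" for x
  proof -
    have p: "p > 1" using assms prime_gt_1_nat by blast
    have "poly F (int x) = (\<Sum>a<p. f a * (1 - (int x - int a) ^ (p - 1)))"
      by (simp add: F_def poly_sum poly_power)
    also have "[\<dots> = (\<Sum>a<p. if a = x then f x else 0)] (mod int p)"
    proof (rule cong_sum)
      fix a assume a: "a \<in> {..<p}"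
      show "[f a * (1 - (int x - int a) ^ (p - 1)) = (if a = x then f x else 0)] (mod int p)"
      proof (cases "a = x")
        case False
        then have "\<not> int p dvd int x - int a"
          using a x by (intro not_dvd_diff_residues) auto
        then have "int p dvd 1 - (int x - int a) ^ (p - 1)"
          using fermat_int[OF assms] by (metis cong_iff_dvd_diff cong_sym)
        then show ?thesis using False by (simp add: cong_0_iff)
      qed (use p in \<open>simp add: zero_power\<close>)
    qed
    also have "(\<Sum>a<p. if a = x then f x else 0) = f x" using x by simp
    finally show ?thesis .
  qed
  ultimately show ?thesis by blast
qed

section \<open>Functions modulo p that determine few directions\<close>

text \<open>The power sum of f x - m x with exponent k = i + j is a polynomial in m that vanishes on
  \<open>M\<close>. Its coefficient of m^k is a power sum of x and already zero modulo p, so k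
  roots, rather than k + 1, suffice to kill the other coefficients.\<close>

lemma moment_dvd:
  fixes p :: nat and f :: "nat \<Rightarrow> int"
  assumes "prime p" "M \<subseteq> {0..<int p}" "i + j \<le> card M" "0 < j" "i + j < p - 1"
    and inj: "\<And>m x y. m \<in> M \<Longrightarrow> x < p \<Longrightarrow> y < p \<Longrightarrow>
        [f x - m * int x = f y - m * int y] (mod int p) \<Longrightarrow> x = y"
  shows "int p dvd (\<Sum>x<p. f x ^ j * int x ^ i)"
proof -
  define k where "k = i + j"
  have p: "p > 1" using assms(1) prime_gt_1_nat by blast
  have k: "0 < k" "k < p - 1" "k \<le> card M" using assms by (auto simp: k_def)
  \<comment> \<open>\<open>c i\<close> is the coefficient of m^i in the power sum; \<open>P\<close>
    omits the top one, \<open>c k\<close>.\<close>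
  define c where "c i = (\<Sum>x<p. int (k choose i) * (- 1) ^ i * (f x ^ (k - i) * int x ^ i))" for i
  define P where "P = (\<Sum>i<k. monom (c i) i)"
  have coeffP: "coeff P n = (if n < k then c n else 0)" for n
    by (simp add: P_def coeff_sum)
  have "degree P < k"
    using k by (intro order.strict_trans1[OF degree_le[of "k - 1"]]) (auto simp: coeffP)
  moreover have "int p dvd poly P m" if m: "m \<in> M" for m
  proof -
    have "(f x - m * int x) ^ k = (\<Sum>i\<le>k. int (k choose i) * (- m * int x) ^ i * f x ^ (k - i))" for x
      using binomial_ring[of "- m * int x" "f x" k] by (simp add: algebra_simps)
    then have "(\<Sum>x<p. (f x - m * int x) ^ k) =
        (\<Sum>i\<le>k. \<Sum>x<p. int (k choose i) * (- m * int x) ^ i * f x ^ (k - i))"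
      by (simp add: sum.swap[of _ "{..<p}"])
    also have "\<dots> = (\<Sum>i\<le>k. c i * m ^ i)"
      by (auto simp: c_def sum_distrib_right power_mult_distrib power_minus[of "m * int x" for x] intro!: sum.cong)
    also have "\<dots> = poly P m + c k * m ^ k"
      by (simp add: P_def poly_sum poly_monom lessThan_Suc_atMost[symmetric])
    finally have eq: "(\<Sum>x<p. (f x - m * int x) ^ k) = poly P m + c k * m ^ k" .
    define g where "g x = nat ((f x - m * int x) mod int p)" for x
    have g: "int (g x) = (f x - m * int x) mod int p" for x
      using p by (simp add: g_def)
    have "inj_on g {..<p}"
    proof (rule inj_onI)
      fix x y assume "x \<in> {..<p}" "y \<in> {..<p}" "g x = g y"
      then show "x = y" using inj[OF m, of x y] g by (metis cong_def lessThan_iff)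
    qed
    moreover have "g ` {..<p} \<subseteq> {..<p}"
      using p by (auto simp: g_def nat_less_iff)
    ultimately have "bij_betw g {..<p} {..<p}"
      by (simp add: bij_betw_def endo_inj_surj)
    then have "(\<Sum>x<p. int (g x) ^ k) = (\<Sum>x<p. int x ^ k)"
      by (rule sum.reindex_bij_betw)
    moreover have "[(\<Sum>x<p. (f x - m * int x) ^ k) = (\<Sum>x<p. int (g x) ^ k)] (mod int p)"
      unfolding g by (intro cong_sum cong_pow) (simp add: cong_def)
    ultimately have "int p dvd (\<Sum>x<p. (f x - m * int x) ^ k)"
      using dvd_power_sum[OF assms(1) k(2)] by (simp add: cong_dvd_iff)
    moreover have "int p dvd c k"
      using dvd_power_sum[OF assms(1) k(2)]
      by (simp add: c_def sum_distrib_left[symmetric])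
    ultimately show ?thesis unfolding eq by (simp add: dvd_add_left_iff)
  qed
  ultimately have "int p dvd coeff P i"
    using assms(1,2) k by (intro dvd_coeff_if_many_roots[of p M]) auto
  then have "int p dvd c i" using assms(4) by (simp add: coeffP k_def)
  then have "int p dvd int (k choose i) * (- 1) ^ i * (\<Sum>x<p. f x ^ j * int x ^ i)"
    by (simp add: c_def sum_distrib_left k_def)
  \<comment> \<open>The binomial coefficient divides k!, and k < p.\<close>
  moreover have "\<not> p dvd (k choose i)"
  proof
    assume "p dvd (k choose i)"
    then have "p dvd fact k"
      by (metis binomial_fact_lemma dvd_mult k_def le_add1)
    then show False using assms(1) k by (simp add: prime_dvd_fact_iff)
  qed
  ultimately show ?thesis
    using assms(1) p by (auto simp: prime_dvd_mult_iff minus_one_power_iff split: if_splits)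
qed

text \<open>Provides exponents: for F of degree d, quotient a and remainder b make F^a X^b of degree
  exactly n while a + b stays in the range of vanishing moments. Evenness of n excludes the
  remainder d - 1 when the quotient is 1 or d = 2, where the bound would fail.\<close>

lemma div_plus_mod_le_half:
  fixes n d :: nat
  assumes "even n" "2 \<le> d" "d \<le> n"
  shows "n div d + n mod d \<le> n div 2"
proof -
  define a b where "a = n div d" and "b = n mod d"
  have n: "n = a * d + b" by (simp add: a_def b_def)
  have b: "b < d" using assms by (simp add: b_def)
  have a: "a \<ge> 1" using assms by (simp add: a_def Suc_le_eq div_greater_zero_iff)
  have "2 * a + 2 * b \<le> n"
  proof (cases "d = 2")
    case True
    then show ?thesis using assms n b by auto
  next
    case False
    then obtain e where e: "d = e + 3" using assms(2) by (metis add.commute le_Suc_ex Suc_leI numeral_3_eq_3 le_neq_implies_less numeral_2_eq_2)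
    show ?thesis
    proof (cases "a = 1")
      case True
      then show ?thesis using n b e assms by presburger
    next
      case False
      then obtain a' where a': "a = a' + 2" using a by (metis add.commute le_Suc_ex Suc_leI le_neq_implies_less numeral_2_eq_2 One_nat_def)
      have "b \<le> e + 2" using b e by simp
      then show ?thesis unfolding n a' e by (simp add: algebra_simps)
    qed
  qed
  then show ?thesis by (simp add: a_def b_def)
qed

text \<open>Let F represent f with least degree d, and let a, b be quotient and remainder of p - 1
  by d. If d >= 2, the sum of f(x)^a x^b is minus the a-th power of the leading coefficient by
  \<open>sum_poly_cong_coeff\<close>, yet zero by \<open>moment_dvd\<close>.\<close>

lemma affine_if_few_directions:
  fixes p :: nat and f :: "nat \<Rightarrow> int"
  assumes "prime p" "odd p" "M \<subseteq> {0..<int p}" "(p - 1) div 2 \<le> card M"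
    and inj: "\<And>m x y. m \<in> M \<Longrightarrow> x < p \<Longrightarrow> y < p \<Longrightarrow>
        [f x - m * int x = f y - m * int y] (mod int p) \<Longrightarrow> x = y"
  shows "\<exists>\<alpha> \<beta>. \<forall>x<p. [f x = \<alpha> * int x + \<beta>] (mod int p)"
proof -
  have p: "p \<ge> 3" using assms(1,2) prime_ge_2_nat[of p] by (cases "p = 2") auto
  define ok where "ok F \<longleftrightarrow> degree F \<le> p - 1 \<and> (\<forall>x<p. [poly F (int x) = f x] (mod int p))" for F :: "int poly"
  obtain F where F: "ok F" "\<And>G. ok G \<Longrightarrow> degree F \<le> degree G"
    using ex_poly_cong[OF assms(1), of f] ex_has_least_nat[of ok _ degree] unfolding ok_def by metis
  define d where "d = degree F"
  have "d \<le> 1"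
  proof (rule ccontr)
    assume "\<not> d \<le> 1"
    then have d: "2 \<le> d" "d \<le> p - 1" using F by (auto simp: d_def ok_def)
    \<comment> \<open>A leading term divisible by p could be dropped without changing values modulo
      p, against minimality of the degree.\<close>
    have lead: "\<not> int p dvd coeff F d"
    proof
      assume dv: "int p dvd coeff F d"
      define G where "G = F - monom (coeff F d) d"
      have degG: "degree G < d"
      proof (rule order.strict_trans1[OF degree_le[of "d - 1"]])
        show "\<forall>i>d - 1. coeff G i = 0"
          using coeff_eq_0[of F] d by (auto simp: G_def d_def[symmetric])
      qed (use d in auto)
      have "[poly G (int x) = f x] (mod int p)" if "x < p" for x
      proof -
        have "[poly F (int x) - coeff F d * int x ^ d = f x - 0] (mod int p)"
          using F that dv by (intro cong_diff) (auto simp: ok_def cong_0_iff)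
        then show ?thesis by (simp add: G_def poly_monom)
      qed
      then have "ok G" using degG d by (auto simp: ok_def)
      then show False using F(2) degG by (force simp: d_def)
    qed
    define a b where "a = (p - 1) div d" and "b = (p - 1) mod d"
    have n: "a * d + b = p - 1" by (simp add: a_def b_def)
    have a: "a > 0" using d by (simp add: a_def div_greater_zero_iff)
    have ab: "b + a \<le> (p - 1) div 2"
      using div_plus_mod_le_half[of "p - 1" d] assms(2) d by (simp add: a_def b_def)
    have F0: "F \<noteq> 0" using lead by auto
    define G where "G = F ^ a * monom 1 b"
    have degG: "degree G = p - 1"
      using F0 n by (simp add: G_def degree_mult_eq degree_power_eq degree_monom_eq d_def)
    have coeffG: "coeff G (p - 1) = coeff F d ^ a"
      using lead_coeff_mult[of "F ^ a" "monom 1 b"] lead_coeff_power[of F a]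
      by (simp add: G_def[symmetric] degG d_def degree_monom_eq)
    have "[f x ^ a * int x ^ b = poly G (int x)] (mod int p)" if "x < p" for x
    proof -
      have "poly G (int x) = poly F (int x) ^ a * int x ^ b"
        by (simp add: G_def poly_monom)
      moreover have "[f x = poly F (int x)] (mod int p)"
        using F(1) that by (simp add: ok_def cong_sym)
      ultimately show ?thesis by (simp add: cong_mult cong_pow)
    qed
    then have "[(\<Sum>x<p. f x ^ a * int x ^ b) = (\<Sum>x<p. poly G (int x))] (mod int p)"
      by (intro cong_sum) simp
    also have "[(\<Sum>x<p. poly G (int x)) = - (coeff F d ^ a)] (mod int p)"
      using sum_poly_cong_coeff[OF assms(1), of G] degG coeffG by simp
    finally have "int p dvd coeff F d ^ a"
      using moment_dvd[OF assms(1,3), of b a f] inj ab assms(4) a p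
      by (auto simp: cong_dvd_iff)
    then show False
      using lead assms(1) by (metis prime_dvd_power prime_nat_int_transfer)
  qed
  then have "poly F x = coeff F 1 * x + coeff F 0" for x
    using poly_eq_sum_le[of F 1 x] by (simp add: d_def algebra_simps)
  then show ?thesis using F(1) unfolding ok_def by (metis cong_sym)
qed

section \<open>Integral distance and similarities in the plane over Z_n\<close>

lemma plane_residue_ring: "plane (residue_ring m) = {0..<m} \<times> {0..<m}"
  by (auto simp: plane_def residue_ring_def)

lemma integral_distance_Zmod_iff:
  fixes n :: nat
  assumes "n > 1" "(x, y) \<in> plane (Zmod n)" "(x', y') \<in> plane (Zmod n)"
  shows "integral_distance (Zmod n) (x, y) (x', y') \<longleftrightarrow>
    (\<exists>s. [(x - x')^2 + (y - y')^2 = s^2] (mod int n))" (is "_ \<longleftrightarrow> ?R")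
proof -
  interpret residues "int n" "Zmod n" using assms(1) by unfold_locales auto
  have sq: "sq_dist (Zmod n) (x, y) (x', y') = ((x - x')^2 + (y - y')^2) mod int n"
    by (simp add: sq_dist_def a_minus_def res_add_eq res_neg_eq numeral_2_eq_2 res_mult_eq
        mod_simps power2_eq_square res_one_eq)
  have "ring_squares (Zmod n) = {s^2 mod int n | s. s \<in> {0..<int n}}"
    using assms(1) by (auto simp: ring_squares_def res_mult_eq power2_eq_square res_carrier_eq)
  also have "\<dots> = {s^2 mod int n | s. True}"
  proof (intro Collect_cong iffI; clarify)
    fix s :: int
    show "\<exists>s'. s^2 mod int n = s'^2 mod int n \<and> s' \<in> {0..<int n}"
      using assms(1) by (intro exI[of _ "s mod int n"]) (simp add: power_mod)
  qed blast
  finally show ?thesis by (auto simp: integral_distance_def sq cong_def)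
qed

lemma ex_inverse_mod:
  fixes a n :: int
  assumes "coprime a n"
  obtains b where "[a * b = 1] (mod n)" "coprime b n"
proof -
  obtain b where b: "[a * b = 1] (mod n)" using cong_solve_coprime_int[OF assms] by blast
  then have "coprime b n"
    by (metis coprime_iff_invertible_int mult.commute)
  with b show ?thesis by (rule that)
qed

text \<open>Up to translation this is multiplication of x + iy by A - iB. Multiplying image
  differences by the conjugate returns the original ones scaled by the unit A^2 + B^2, so the map is
  injective, hence bijective on the finite plane.\<close>

lemma bij_betw_similarity:
  fixes n :: nat
  assumes "n > 1" "coprime (A^2 + B^2) (int n)"
  shows "bij_betw (\<lambda>(x, y). ((A * x + B * y + k) mod int n, (A * y - B * x + l) mod int n))
    (plane (Zmod n)) (plane (Zmod n))" (is "bij_betw ?\<phi> _ _")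
proof -
  let ?P = "{0..<int n} \<times> {0..<int n}"
  have "inj_on ?\<phi> ?P"
  proof (rule inj_onI; clarify)
    fix x y x' y' :: int
    assume range: "x \<in> {0..<int n}" "y \<in> {0..<int n}" "x' \<in> {0..<int n}" "y' \<in> {0..<int n}"
      and "(A * x + B * y + k) mod int n = (A * x' + B * y' + k) mod int n"
        "(A * y - B * x + l) mod int n = (A * y' - B * x' + l) mod int n"
    then have d: "int n dvd A * (x - x') + B * (y - y')" "int n dvd A * (y - y') - B * (x - x')"
      by (auto simp: mod_eq_dvd_iff algebra_simps)
    have "(A^2 + B^2) * (x - x') = A * (A * (x - x') + B * (y - y')) - B * (A * (y - y') - B * (x - x'))"
      "(A^2 + B^2) * (y - y') = B * (A * (x - x') + B * (y - y')) + A * (A * (y - y') - B * (x - x'))"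
      by (simp_all add: algebra_simps power2_eq_square)
    then have "int n dvd (A^2 + B^2) * (x - x')" "int n dvd (A^2 + B^2) * (y - y')"
      using d by (simp_all add: dvd_diff dvd_add)
    then have "int n dvd x - x'" "int n dvd y - y'"
      using assms(2) by (auto simp: coprime_dvd_mult_right_iff coprime_commute)
    then show "x = x' \<and> y = y'"
      using range not_dvd_diff_residues by blast
  qed
  moreover have "?\<phi> ` ?P \<subseteq> ?P" using assms(1) by auto
  ultimately show ?thesis
    using assms(1) by (simp add: bij_betw_def endo_inj_surj plane_residue_ring)
qed

text \<open>Squared distances are multiplied by the square of a unit, which neither creates nor
  destroys squares. Lines are preserved because the map is affine; the new direction is its linear
  part applied to the old one.\<close>

lemma plane_automorphism_similarity:
  fixes n :: nat
  assumes "n > 1" "[A^2 + B^2 = s^2] (mod int n)" "coprime s (int n)"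
  shows "plane_automorphism (Zmod n)
    (\<lambda>(x, y). ((A * x + B * y + k) mod int n, (A * y - B * x + l) mod int n))"
    (is "plane_automorphism _ ?\<phi>")
proof -
  interpret residues "int n" "Zmod n" using assms(1) by unfold_locales auto
  have cop: "coprime (A^2 + B^2) (int n)"
    using assms(2,3) by (metis cong_imp_coprime cong_sym coprime_power_left_iff)
  have bij: "bij_betw ?\<phi> (plane (Zmod n)) (plane (Zmod n))"
    using bij_betw_similarity[OF assms(1) cop] .
  then have range: "?\<phi> u \<in> plane (Zmod n)" if "u \<in> plane (Zmod n)" for u
    using that bij_betwE by blast
  have "Delta (Zmod n) (?\<phi> (x, y)) (?\<phi> (x', y')) = Delta (Zmod n) (x, y) (x', y')"
    if uv: "(x, y) \<in> plane (Zmod n)" "(x', y') \<in> plane (Zmod n)" for x y x' y'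
  proof -
    let ?N = "(x - x')^2 + (y - y')^2"
    let ?N' = "((A * x + B * y + k) mod int n - (A * x' + B * y' + k) mod int n)^2
      + ((A * y - B * x + l) mod int n - (A * y' - B * x' + l) mod int n)^2"
    have "[?N' = ((A * x + B * y + k) - (A * x' + B * y' + k))^2
      + ((A * y - B * x + l) - (A * y' - B * x' + l))^2] (mod int n)"
      by (intro cong_add cong_pow cong_diff) (simp_all add: cong_def)
    also have "((A * x + B * y + k) - (A * x' + B * y' + k))^2
      + ((A * y - B * x + l) - (A * y' - B * x' + l))^2 = (A^2 + B^2) * ?N"
      by (simp add: algebra_simps power2_eq_square)
    also have "[\<dots> = s^2 * ?N] (mod int n)"
      using assms(2) by (rule cong_scalar_right)
    finally have N': "[?N' = s^2 * ?N] (mod int n)" .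
    obtain e where e: "[s * e = 1] (mod int n)" by (rule ex_inverse_mod[OF assms(3)])
    have "(\<exists>r. [?N' = r^2] (mod int n)) \<longleftrightarrow> (\<exists>r. [?N = r^2] (mod int n))"
    proof safe
      fix r assume "[?N' = r^2] (mod int n)"
      then have "[e^2 * (s^2 * ?N) = e^2 * r^2] (mod int n)"
        by (intro cong_scalar_left cong_trans[OF cong_sym[OF N']])
      moreover have "[(s * e)^2 * ?N = 1^2 * ?N] (mod int n)"
        by (intro cong_scalar_right cong_pow e)
      moreover have "e^2 * (s^2 * ?N) = (s * e)^2 * ?N" "e^2 * r^2 = (e * r)^2" "1^2 * ?N = ?N"
        by (simp_all add: power_mult_distrib)
      ultimately have "[?N = (e * r)^2] (mod int n)"
        by (metis cong_sym cong_trans)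
      then show "\<exists>r. [?N = r^2] (mod int n)" ..
    next
      fix r assume "[?N = r^2] (mod int n)"
      then have "[s^2 * ?N = (s * r)^2] (mod int n)"
        by (simp add: power_mult_distrib cong_scalar_left)
      then show "\<exists>r. [?N' = r^2] (mod int n)"
        using N' cong_trans by blast
    qed
    then show ?thesis
      using range[OF uv(1)] range[OF uv(2)] uv assms(1)
      by (simp add: Delta_def integral_distance_Zmod_iff)
  qed
  moreover have "\<exists>u'\<in>plane (Zmod n). \<exists>w'\<in>plane (Zmod n).
      ?\<phi> ` plane_line (Zmod n) (x, y) (a, b) = plane_line (Zmod n) u' w'"
    if uw: "(x, y) \<in> plane (Zmod n)" "(a, b) \<in> plane (Zmod n)" for x y a b
  proof (intro bexI)
    let ?w = "((A * a + B * b) mod int n, (A * b - B * a) mod int n)"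
    have line: "plane_line (Zmod n) u w =
      (\<lambda>t. ((fst u + t * fst w) mod int n, (snd u + t * snd w) mod int n)) ` carrier (Zmod n)" for u w
      by (auto simp: plane_line_def res_add_eq res_mult_eq mod_simps)
    show "?\<phi> ` plane_line (Zmod n) (x, y) (a, b) = plane_line (Zmod n) (?\<phi> (x, y)) ?w"
      unfolding line image_image
    proof (rule image_cong[OF refl], simp, intro conjI)
      fix t
      have "[A * ((x + t * a) mod int n) + B * ((y + t * b) mod int n) + k =
        A * (x + t * a) + B * (y + t * b) + k] (mod int n)"
        by (intro cong_add cong_scalar_left) (simp_all add: cong_def)
      also have "A * (x + t * a) + B * (y + t * b) + k = A * x + B * y + k + t * (A * a + B * b)"
        by (simp add: algebra_simps)
      also have "[\<dots> = (A * x + B * y + k) mod int n + t * ((A * a + B * b) mod int n)] (mod int n)"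
        by (intro cong_add cong_scalar_left) (simp_all add: cong_def)
      finally show "(A * ((x + t * a) mod int n) + B * ((y + t * b) mod int n) + k) mod int n =
        ((A * x + B * y + k) mod int n + t * ((A * a + B * b) mod int n)) mod int n"
        unfolding cong_def .
      have "[A * ((y + t * b) mod int n) - B * ((x + t * a) mod int n) + l =
        A * (y + t * b) - B * (x + t * a) + l] (mod int n)"
        by (intro cong_add cong_diff cong_scalar_left) (simp_all add: cong_def)
      also have "A * (y + t * b) - B * (x + t * a) + l = A * y - B * x + l + t * (A * b - B * a)"
        by (simp add: algebra_simps)
      also have "[\<dots> = (A * y - B * x + l) mod int n + t * ((A * b - B * a) mod int n)] (mod int n)"
        by (intro cong_add cong_scalar_left) (simp_all add: cong_def)
      finally show "(A * ((y + t * b) mod int n) - B * ((x + t * a) mod int n) + l) mod int n =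
        ((A * y - B * x + l) mod int n + t * ((A * b - B * a) mod int n)) mod int n"
        unfolding cong_def .
    qed
    show "?w \<in> plane (Zmod n)" using assms(1) by (simp add: plane_residue_ring)
  qed (rule range[OF uw(1)])
  ultimately show ?thesis
    using bij unfolding plane_automorphism_def by auto
qed

section \<open>Non-squares of the form 1 + t^2, and slopes without non-zero square norm\<close>

text \<open>Otherwise adding 1 to a square always gives a square, so by induction from 0 all
  residues are squares. Squaring would then be surjective, hence injective, although 1 and -1 are
  distinct with equal squares.\<close>

lemma ex_one_plus_square_nonsquare:
  fixes p :: nat
  assumes "p \<ge> 3"
  shows "\<exists>t::int. \<forall>s. \<not> [1 + t^2 = s^2] (mod int p)"
proof (rule ccontr)
  assume "\<nexists>t::int. \<forall>s. \<not> [1 + t^2 = s^2] (mod int p)"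
  then have step: "\<exists>s. [1 + t^2 = s^2] (mod int p)" for t :: int by blast
  have sq: "\<exists>s. [int n = s^2] (mod int p)" for n
  proof (induction n)
    case 0
    show ?case by (intro exI[of _ 0]) simp
  next
    case (Suc n)
    then obtain s where "[int n = s^2] (mod int p)" by blast
    then have "[int (Suc n) = 1 + s^2] (mod int p)" by (simp add: cong_add_lcancel)
    then show ?case using step[of s] cong_trans by blast
  qed
  let ?h = "\<lambda>x. x^2 mod int p"
  have "{0..<int p} \<subseteq> ?h ` {0..<int p}"
  proof
    fix x assume x: "x \<in> {0..<int p}"
    obtain s where "[x = s^2] (mod int p)" using sq[of "nat x"] x by auto
    then have "x = ?h (s mod int p)" using x by (simp add: cong_def power_mod)
    then show "x \<in> ?h ` {0..<int p}" using assms by simp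
  qed
  then have "inj_on ?h {0..<int p}"
    using assms by (intro finite_surj_inj) auto
  moreover have "?h 1 = ?h (int p - 1)"
    by (simp add: mod_eq_dvd_iff power2_eq_square algebra_simps)
  moreover have "1 \<in> {0..<int p}" "int p - 1 \<in> {0..<int p}" using assms by auto
  ultimately have "1 = int p - 1" by (rule inj_onD)
  then show False using assms by simp
qed

text \<open>With x - t y as the first coordinate, slope m belongs to the direction (1 + m t, m). The
  slopes to be avoided give points on the conic c^2 = (1 + m t)^2 + m^2, which are counted by
  projecting from (m, c) = (0, 1).\<close>

lemma card_nonsquare_slopes:
  fixes p :: nat and t :: int
  assumes "prime p" "p \<ge> 3" and nonsq: "\<And>s. \<not> [1 + t^2 = s^2] (mod int p)"
  shows "(p - 1) div 2 \<le> card {m \<in> {0..<int p}. \<forall>s. [(1 + m * t)^2 + m^2 = s^2] (mod int p) \<longrightarrow> int p dvd s}"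
    (is "_ \<le> card ?M")
proof -
  have ip: "prime (int p)" using assms(1) by simp
  define Q where "Q = {m \<in> {1..<int p}. \<exists>s. [(1 + m * t)^2 + m^2 = s^2] (mod int p) \<and> \<not> int p dvd s}"
  have "\<forall>m\<in>Q. \<exists>s. [(1 + m * t)^2 + m^2 = s^2] (mod int p) \<and> \<not> int p dvd s" by (auto simp: Q_def)
  then obtain c where c: "[(1 + m * t)^2 + m^2 = c m^2] (mod int p)" "\<not> int p dvd c m" if "m \<in> Q" for m
    by metis
  have ndvd: "\<not> int p dvd m" if "m \<in> Q" for m
    using that by (auto simp: Q_def dest: zdvd_imp_le)
  \<comment> \<open>The number \<open>s\<close> is the slope of the line joining (0, 1) to (m, e c
    m). Every m in \<open>Q\<close> yields two such points, for e = 1 and e = -1.\<close>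
  have "\<exists>s\<in>{0..<int p}. int p dvd s * m - (e * c m - 1)" if m: "m \<in> Q" for m e
  proof -
    have "coprime m (int p)"
      using prime_imp_coprime[OF ip ndvd[OF m]] by (simp add: coprime_commute)
    then obtain b where b: "[m * b = 1] (mod int p)" by (rule ex_inverse_mod)
    have "[((b * (e * c m - 1)) mod int p) * m = (b * (e * c m - 1)) * m] (mod int p)"
      by (intro cong_scalar_right) (simp add: cong_def)
    also have "(b * (e * c m - 1)) * m = (m * b) * (e * c m - 1)" by simp
    also have "[\<dots> = 1 * (e * c m - 1)] (mod int p)" using b by (rule cong_scalar_right)
    finally show ?thesis
      using assms(2) by (intro bexI[of _ "(b * (e * c m - 1)) mod int p"]) (auto simp: cong_iff_dvd_diff)
  qed
  then obtain \<sigma> where \<sigma>: "\<sigma> m e \<in> {0..<int p}" "int p dvd \<sigma> m e * m - (e * c m - 1)" if "m \<in> Q" for m e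
    by metis
  \<comment> \<open>Substituting the line into the conic and cancelling m leaves a linear equation
    for the second intersection.\<close>
  have key: "int p dvd (\<sigma> m e^2 - (1 + t^2)) * m - 2 * (t - \<sigma> m e)" if "m \<in> Q" "e \<in> {1, -1}" for m e
  proof -
    let ?s = "\<sigma> m e"
    have "e^2 = 1" using that(2) by auto
    have "[(?s * m + 1)^2 = (e * c m)^2] (mod int p)"
      using \<sigma>(2)[OF that(1), of e] by (intro cong_pow) (simp add: cong_iff_dvd_diff algebra_simps)
    also have "(e * c m)^2 = c m^2" using \<open>e^2 = 1\<close> by (simp add: power_mult_distrib)
    also have "[\<dots> = (1 + m * t)^2 + m^2] (mod int p)" using c(1)[OF that(1)] by (rule cong_sym)
    finally have "int p dvd (?s * m + 1)^2 - ((1 + m * t)^2 + m^2)" by (simp add: cong_iff_dvd_diff)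
    also have "(?s * m + 1)^2 - ((1 + m * t)^2 + m^2) = m * ((?s^2 - (1 + t^2)) * m - 2 * (t - ?s))"
      by (simp add: algebra_simps power2_eq_square)
    finally show ?thesis
      using ndvd[OF that(1)] ip by (simp add: prime_dvd_mult_iff)
  qed
  have "card (Q \<times> {1, -1 :: int}) \<le> card ({0..<int p} - {t mod int p})"
  proof (rule card_inj_on_le)
    show "inj_on (\<lambda>(m, e). \<sigma> m e) (Q \<times> {1, -1})"
    proof (rule inj_onI; clarify)
      fix m e m' e' assume m: "m \<in> Q" "m' \<in> Q" and e: "e \<in> {1, -1 :: int}" "e' \<in> {1, -1 :: int}"
        and eq: "\<sigma> m e = \<sigma> m' e'"
      let ?s = "\<sigma> m e"
      have "int p dvd ((?s^2 - (1 + t^2)) * m - 2 * (t - ?s)) - ((?s^2 - (1 + t^2)) * m' - 2 * (t - ?s))"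
        using dvd_diff[OF key[OF m(1) e(1)] key[OF m(2) e(2), folded eq]] .
      then have "int p dvd (?s^2 - (1 + t^2)) * (m - m')" by (simp add: algebra_simps)
      \<comment> \<open>The coefficient of m is non-zero because 1 + t^2 is a non-square, so the
        slope determines m.\<close>
      moreover have "\<not> int p dvd ?s^2 - (1 + t^2)"
        using nonsq[of ?s] by (metis cong_iff_dvd_diff cong_sym)
      ultimately have "int p dvd m - m'" using ip by (simp add: prime_dvd_mult_iff)
      moreover have "m \<in> {0..<int p}" "m' \<in> {0..<int p}" using m by (auto simp: Q_def)
      ultimately have mm: "m = m'" using not_dvd_diff_residues by blast
      have "e = e'"
      proof (rule ccontr)
        assume ne: "e \<noteq> e'"
        have "int p dvd (?s * m - (e' * c m - 1)) - (?s * m - (e * c m - 1))"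
          using dvd_diff[OF \<sigma>(2)[OF m(2), of e', folded eq mm] \<sigma>(2)[OF m(1), of e]] .
        then have "int p dvd (e - e') * c m" by (simp add: algebra_simps)
        moreover have "e - e' = 2 \<or> e - e' = - 2" using e ne by auto
        ultimately have "int p dvd 2"
          using c(2)[OF m(1)] ip by (auto simp: prime_dvd_mult_iff)
        then show False using assms(2) by (auto dest: zdvd_imp_le)
      qed
      with mm show "m = m' \<and> e = e'" by simp
    qed
    show "(\<lambda>(m, e). \<sigma> m e) ` (Q \<times> {1, -1}) \<subseteq> {0..<int p} - {t mod int p}"
    proof (rule image_subsetI; clarify)
      fix m e assume me: "m \<in> Q" "e \<in> {1, -1 :: int}"
      \<comment> \<open>Slope t is that of the tangent at (0, 1), which has no second
        intersection.\<close>
      have "\<sigma> m e \<noteq> t mod int p"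
      proof
        assume eq: "\<sigma> m e = t mod int p"
        then have dv: "int p dvd \<sigma> m e - t" by (simp add: mod_eq_dvd_iff[symmetric])
        have "m = (\<sigma> m e - t) * ((\<sigma> m e + t) * m + 2) - ((\<sigma> m e^2 - (1 + t^2)) * m - 2 * (t - \<sigma> m e))"
          by (simp add: algebra_simps power2_eq_square)
        then have "int p dvd m" using dv key[OF me] by (metis dvd_diff dvd_mult2)
        then show False using ndvd[OF me(1)] by simp
      qed
      then show "\<sigma> m e \<in> {0..<int p} - {t mod int p}" using \<sigma>(1)[OF me(1), of e] by simp
    qed
  qed simp
  then have Q2: "2 * card Q \<le> p - 1"
    using assms(2) by (simp add: card_Diff_subset card_cartesian_product)
  have sub: "Q \<subseteq> {1..<int p}" by (auto simp: Q_def)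
  then have fin: "finite Q" by (rule finite_subset) simp
  have "card ({1..<int p} - Q) = p - 1 - card Q"
    using sub fin by (simp add: card_Diff_subset)
  moreover have "card ({1..<int p} - Q) \<le> card ?M"
    by (rule card_mono[OF finite_subset[of _ "{0..<int p}"]]) (auto simp: Q_def)
  ultimately show ?thesis using Q2 by linarith
qed

section \<open>The set (a): description, cardinality, integrality\<close>

lemma div_in_residues:
  fixes p :: nat
  assumes "a \<in> {0..<int (p^2)}"
  shows "a div int p \<in> {0..<int p}"
proof -
  have p: "p > 0" using assms by (cases p) auto
  then have "(a div int p) * int p \<le> a"
    using div_mult_mod_eq[of a "int p"] pos_mod_sign[of "int p" a] by linarith
  also have "a < int p * int p" using assms by (simp add: power2_eq_square)
  finally have "a div int p < int p" using p by simp
  then show ?thesis using assms p by (auto simp: pos_imp_zdiv_nonneg_iff)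
qed

lemma set_a_eq:
  assumes "prime p"
  shows "set_a p = {(x, y) \<in> plane (Zmod (p^2)). int p dvd y}"
proof -
  have p: "p > 0" "p^2 > 1" using assms prime_gt_1_nat[of p] one_less_power[of p 2] by auto
  have carrier: "carrier (Zmod (p^2)) = {0..<int (p^2)}" by (auto simp: residue_ring_def)
  have mult: "j \<otimes>\<^bsub>Zmod (p^2)\<^esub> int p = j * int p mod int (p^2)" for j
    by (simp add: residue_ring_def)
  have "set_a p = {0..<int (p^2)} \<times> (\<lambda>j. j * int p mod int (p^2)) ` {0..<int (p^2)}"
    unfolding set_a_def carrier mult by blast
  also have "(\<lambda>j. j * int p mod int (p^2)) ` {0..<int (p^2)} = {y \<in> {0..<int (p^2)}. int p dvd y}"
  proof (intro subset_antisym subsetI)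
    fix y assume y: "y \<in> {y \<in> {0..<int (p^2)}. int p dvd y}"
    then have "y = (y div int p) * int p mod int (p^2)" by simp
    moreover have "{0..<int p} \<subseteq> {0..<int (p^2)}"
      using self_le_power[of p 2] p(1) by (intro ivl_subset[THEN iffD2]) (simp only: of_nat_le_iff, simp)
    then have "y div int p \<in> {0..<int (p^2)}"
      using y div_in_residues[of y p] by blast
    ultimately show "y \<in> (\<lambda>j. j * int p mod int (p^2)) ` {0..<int (p^2)}" by (rule image_eqI)
  next
    fix y assume "y \<in> (\<lambda>j. j * int p mod int (p^2)) ` {0..<int (p^2)}"
    then obtain j where y: "y = j * int p mod int (p^2)" by blast
    have "int p dvd y" unfolding y by (rule dvd_mod) simp_all
    moreover have "y \<in> {0..<int (p^2)}" unfolding y using p by simp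
    ultimately show "y \<in> {y \<in> {0..<int (p^2)}. int p dvd y}" by simp
  qed
  finally show ?thesis unfolding plane_residue_ring by blast
qed

lemma card_set_a:
  assumes "prime p"
  shows "card (set_a p) = p^3"
proof -
  have p: "p > 0" "p^2 > 1" using assms prime_gt_1_nat[of p] one_less_power[of p 2] by auto
  have "set_a p = (\<lambda>(i, j). (i, j * int p)) ` ({0..<int (p^2)} \<times> {0..<int p})" (is "_ = ?f ` ?D")
  proof
    show "set_a p \<subseteq> ?f ` ?D"
    proof
      fix u assume "u \<in> set_a p"
      then obtain x y where u: "u = (x, y)" "x \<in> {0..<int (p^2)}" "y \<in> {0..<int (p^2)}" "int p dvd y"
        by (auto simp: set_a_eq[OF assms] plane_residue_ring)
      then obtain j where j: "y = j * int p" by (metis dvdE mult.commute)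
      then have "j \<in> {0..<int p}" using u p by (auto simp: power2_eq_square zero_le_mult_iff)
      then show "u \<in> ?f ` ?D" using u j by force
    qed
    show "?f ` ?D \<subseteq> set_a p"
      using p by (auto simp: set_a_eq[OF assms] plane_residue_ring power2_eq_square)
  qed
  moreover have "inj_on ?f ?D" using p by (auto simp: inj_on_def)
  ultimately show ?thesis
    by (simp add: card_image card_cartesian_product power2_eq_square power3_eq_cube
        flip: of_nat_mult)
qed

text \<open>Second coordinates differ by a multiple of p, whose square vanishes modulo p^2, so the
  squared distance is (x - x')^2.\<close>

lemma integral_set_a:
  assumes "prime p"
  shows "integral_point_set (Zmod (p^2)) (set_a p)"
proof -
  have p: "p^2 > 1" using assms prime_gt_1_nat[of p] one_less_power[of p 2] by auto
  have "integral_distance (Zmod (p^2)) (x, y) (x', y')"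
    if "(x, y) \<in> set_a p" "(x', y') \<in> set_a p" for x y x' y'
  proof -
    have "int p dvd y - y'" using that by (auto simp: set_a_eq[OF assms])
    then have "int (p^2) dvd (y - y')^2" by simp
    then have "[(x - x')^2 + (y - y')^2 = (x - x')^2] (mod int (p^2))"
      by (simp add: cong_iff_dvd_diff)
    then show ?thesis
      using that integral_distance_Zmod_iff[OF p] unfolding set_a_eq[OF assms] by blast
  qed
  then show ?thesis
    by (auto simp: integral_point_set_def set_a_eq[OF assms])
qed

section \<open>The upper bound for integral sets modulo p^2\<close>

text \<open>The p-adic valuation of a non-zero square is even, so a square modulo p^2 cannot be
  divisible by p exactly once.\<close>

lemma square_cong_dvd:
  fixes p N s :: int
  assumes "prime p" "p dvd N" "[N = s^2] (mod p^2)"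
  shows "p^2 dvd N"
proof -
  have "p dvd s^2"
    using assms(2,3) by (metis cong_dvd_iff cong_modulus_mult power2_eq_square)
  then have "p^2 dvd s^2" using assms(1) by (simp add: prime_dvd_power_iff)
  then show ?thesis using assms(3) by (simp add: cong_dvd_iff)
qed

locale integral_set_mod_prime_square =
  fixes p :: nat and S :: "(int \<times> int) set" and t :: int
  assumes prime: "prime p" and p3: "p \<ge> 3"
    and integral: "integral_point_set (Zmod (p^2)) S"
    and nonsquare: "\<And>s. \<not> [1 + t^2 = s^2] (mod int p)"
begin

lemma prime_int: "prime (int p)" using prime by simp

lemma square_gt_1: "p^2 > 1" using p3 one_less_power[of p 2] by simp

lemma mod_p_if_mod_square: "[a = b] (mod int (p^2)) \<Longrightarrow> [a = b] (mod int p)"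
  by (metis cong_modulus_mult of_nat_mult power2_eq_square)

lemma in_range: "(x, y) \<in> S \<Longrightarrow> x \<in> {0..<int (p^2)} \<and> y \<in> {0..<int (p^2)}"
  using integral plane_residue_ring by (auto simp: integral_point_set_def)

lemma dist_square:
  assumes "(x, y) \<in> S" "(x', y') \<in> S"
  obtains s where "[(x - x')^2 + (y - y')^2 = s^2] (mod int (p^2))"
  using integral assms integral_distance_Zmod_iff[OF square_gt_1]
  unfolding integral_point_set_def by blast

text \<open>The root is \<open>s\<close> times an inverse of \<open>d\<close>. The implication
  records that dividing by a unit cannot make a non-zero root vanish.\<close>

lemma square_factor:
  assumes "[a * d^2 = s^2] (mod int p)" "\<not> int p dvd d"
  obtains r where "[a = r^2] (mod int p)" "int p dvd r \<longrightarrow> int p dvd s"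
proof -
  have "coprime d (int p)"
    using prime_imp_coprime[OF prime_int assms(2)] by (simp add: coprime_commute)
  then obtain e where e: "[d * e = 1] (mod int p)" "coprime e (int p)" by (rule ex_inverse_mod)
  have "[a * (d * e)^2 = a * 1^2] (mod int p)"
    by (intro cong_scalar_left cong_pow e)
  moreover have "[a * d^2 * e^2 = s^2 * e^2] (mod int p)"
    by (intro cong_scalar_right assms)
  ultimately have "[a = (s * e)^2] (mod int p)"
    by (simp add: power_mult_distrib mult.assoc) (metis cong_sym cong_trans)
  moreover have "int p dvd s * e \<longrightarrow> int p dvd s"
    using e(2) by (simp add: coprime_dvd_mult_left_iff coprime_commute)
  ultimately show ?thesis by (rule that)
qed

text \<open>The difference is y - y' times (t, 1) modulo p, with norm (1 + t^2)(y - y')^2. If y - y'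
  were a unit, 1 + t^2 would be a square.\<close>

lemma class_unique:
  assumes "(x, y) \<in> S" "(x', y') \<in> S" "[x - t * y = x' - t * y'] (mod int p)"
  shows "int p dvd x - x'" "int p dvd y - y'"
proof -
  obtain s where "[(x - x')^2 + (y - y')^2 = s^2] (mod int (p^2))"
    using dist_square[OF assms(1,2)] .
  then have s: "[(x - x')^2 + (y - y')^2 = s^2] (mod int p)" by (rule mod_p_if_mod_square)
  have dx: "[x - x' = t * (y - y')] (mod int p)"
    using assms(3) by (simp add: cong_iff_dvd_diff algebra_simps)
  have "(1 + t^2) * (y - y')^2 = (t * (y - y'))^2 + (y - y')^2"
    by (simp add: distrib_right power_mult_distrib)
  also have "[\<dots> = (x - x')^2 + (y - y')^2] (mod int p)"
    by (intro cong_add cong_pow cong_sym[OF dx] cong_refl)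
  also note s
  finally have eq: "[(1 + t^2) * (y - y')^2 = s^2] (mod int p)" .
  show dy: "int p dvd y - y'"
  proof (rule ccontr)
    assume "\<not> int p dvd y - y'"
    then obtain r where "[1 + t^2 = r^2] (mod int p)" by (rule square_factor[OF eq])
    then show False using nonsquare by blast
  qed
  then show "int p dvd x - x'" using dx by (simp add: cong_dvd_iff)
qed

text \<open>By \<open>class_unique\<close> the first entry fixes the residues modulo p of a point of
  \<open>S\<close>; the quotients supply the remaining base-p digits.\<close>

definition code :: "int \<times> int \<Rightarrow> int \<times> int \<times> int" where
  "code = (\<lambda>(x, y). ((x - t * y) mod int p, x div int p, y div int p))"

lemma inj_on_code: "inj_on code S"
proof (rule inj_onI; clarify)
  fix x y x' y' assume S: "(x, y) \<in> S" "(x', y') \<in> S" and eq: "code (x, y) = code (x', y')"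
  then have "[x - t * y = x' - t * y'] (mod int p)" by (simp add: code_def cong_def)
  from class_unique[OF S this] have "x mod int p = x' mod int p" "y mod int p = y' mod int p"
    by (simp_all add: mod_eq_dvd_iff)
  moreover have "x div int p = x' div int p" "y div int p = y' div int p"
    using eq by (simp_all add: code_def)
  ultimately show "x = x' \<and> y = y'" by (metis div_mult_mod_eq)
qed

lemma code_range:
  assumes "x \<in> {0..<int (p^2)}" "y \<in> {0..<int (p^2)}"
  shows "code (x, y) \<in> {0..<int p} \<times> {0..<int p} \<times> {0..<int p}"
  using assms[THEN div_in_residues] p3 by (simp add: code_def)

lemma code_image_subset: "code ` S \<subseteq> {0..<int p} \<times> {0..<int p} \<times> {0..<int p}"
proof (rule image_subsetI)
  fix u assume "u \<in> S"
  then show "code u \<in> {0..<int p} \<times> {0..<int p} \<times> {0..<int p}"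
    using code_range in_range by (cases u) blast
qed

lemma card_le: "card S \<le> p^3"
  using card_inj_on_le[OF inj_on_code code_image_subset]
  by (simp add: card_cartesian_product power3_eq_cube)

end

section \<open>Structure of integral sets with p^3 points\<close>

locale maximum_integral_set_mod_prime_square = integral_set_mod_prime_square +
  assumes card: "card S = p^3"
begin

text \<open>Extremality enters here: an injection between sets of size p^3 is onto.\<close>

lemma code_image: "code ` S = {0..<int p} \<times> {0..<int p} \<times> {0..<int p}"
  using code_image_subset card_image[OF inj_on_code] card
  by (intro card_subset_eq) (auto simp: card_cartesian_product power3_eq_cube)

lemma class_exists:
  obtains x y where "(x, y) \<in> S" "[x - t * y = c] (mod int p)"
proof -
  have "(c mod int p, 0, 0) \<in> code ` S" unfolding code_image using p3 by auto
  then show ?thesis using that by (force simp: code_def cong_def)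
qed

text \<open>Some point of \<open>S\<close> has the same code as (x', y'). By
  \<open>class_unique\<close> it is congruent to (x, y), hence to (x', y'), modulo p; as the
  quotients agree too, it equals (x', y').\<close>

lemma saturated:
  assumes "(x, y) \<in> S" "x' \<in> {0..<int (p^2)}" "y' \<in> {0..<int (p^2)}"
    and "int p dvd x' - x" "int p dvd y' - y"
  shows "(x', y') \<in> S"
proof -
  have "code (x', y') \<in> code ` S"
    unfolding code_image using code_range[OF assms(2,3)] .
  then obtain a b where ab: "(a, b) \<in> S" "code (x', y') = code (a, b)" by auto
  have "int p dvd (x' - x) - t * (y' - y)" using assms(4,5) by simp
  then have "[x' - t * y' = x - t * y] (mod int p)" by (simp add: cong_iff_dvd_diff algebra_simps)
  then have "[a - t * b = x - t * y] (mod int p)"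
    using ab(2) by (simp add: code_def cong_def)
  note cl = class_unique[OF ab(1) assms(1) this]
  have "int p dvd (x' - x) - (a - x)" "int p dvd (y' - y) - (b - y)"
    by (rule dvd_diff[OF assms(4) cl(1)], rule dvd_diff[OF assms(5) cl(2)])
  then have "x' mod int p = a mod int p" "y' mod int p = b mod int p"
    by (simp_all add: mod_eq_dvd_iff)
  moreover have "x' div int p = a div int p" "y' div int p = b div int p"
    using ab(2) by (simp_all add: code_def)
  ultimately have "x' = a" "y' = b" by (metis div_mult_mod_eq)+
  then show ?thesis using ab(1) by simp
qed

text \<open>Shifting \<open>x\<close> by \<open>p\<close> stays inside the saturated set but changes the squared distance by
  \<open>2 p (x - x')\<close>, whereas a square divisible by \<open>p\<close> must vanish modulo \<open>p\<^sup>2\<close>.\<close>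

lemma no_isotropic_pair:
  assumes "(x, y) \<in> S" "(x', y') \<in> S" "int p dvd (x - x')^2 + (y - y')^2"
  shows "int p dvd x - x'" "int p dvd y - y'"
proof -
  let ?N = "(x - x')^2 + (y - y')^2"
  have odd: "\<not> int p dvd 2" using p3 by (auto dest: zdvd_imp_le)
  obtain s where "[?N = s^2] (mod int (p^2))" using dist_square[OF assms(1,2)] .
  then have N: "int p^2 dvd ?N"
    using square_cong_dvd[OF prime_int assms(3)] by simp
  define x1 where "x1 = (x + int p) mod int (p^2)"
  have x1: "[x1 = x + int p] (mod int (p^2))" by (simp add: x1_def cong_def)
  then have "[x1 = x + int p] (mod int p)" by (rule mod_p_if_mod_square)
  then have "int p dvd x1 - x"
    by (simp add: cong_iff_dvd_diff) (metis diff_diff_eq dvd_add_right_iff dvd_refl diff_add_cancel add.commute)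
  then have "(x1, y) \<in> S"
    using in_range[OF assms(1)] p3 by (intro saturated[OF assms(1)]) (auto simp: x1_def)
  then obtain s1 where "[(x1 - x')^2 + (y - y')^2 = s1^2] (mod int (p^2))"
    using dist_square assms(2) by blast
  moreover have "[(x + int p - x')^2 + (y - y')^2 = (x1 - x')^2 + (y - y')^2] (mod int (p^2))"
    by (intro cong_add cong_pow cong_diff cong_sym[OF x1] cong_refl)
  ultimately have "[(x + int p - x')^2 + (y - y')^2 = s1^2] (mod int p^2)"
    unfolding of_nat_power by (rule cong_trans[rotated])
  moreover have eq: "(x + int p - x')^2 + (y - y')^2 = ?N + int p * (2 * (x - x')) + int p^2"
    by (simp add: algebra_simps power2_eq_square)
  moreover have "int p dvd ?N + int p * (2 * (x - x')) + int p^2"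
    using assms(3) by (simp add: power2_eq_square)
  ultimately have "int p^2 dvd ?N + int p * (2 * (x - x')) + int p^2"
    using square_cong_dvd[OF prime_int] by metis
  then have "int p^2 dvd int p * (2 * (x - x'))"
    using N by (simp add: dvd_add_left_iff dvd_add_right_iff)
  then have "int p dvd 2 * (x - x')" using p3 by (simp add: power2_eq_square)
  then show dx: "int p dvd x - x'" using odd prime_dvd_mult_iff[OF prime_int] by blast
  then have "int p dvd (x - x')^2" by (simp add: power2_eq_square)
  then have "int p dvd (y - y')^2" using assms(3) by (simp add: dvd_add_right_iff)
  then show "int p dvd y - y'" using prime_int prime_dvd_power by blast
qed

text \<open>One chosen point of \<open>S\<close> for each value of x - t y gives the function f. A
  slope in \<open>M\<close> cannot occur between chosen points: a non-square norm contradicts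
  integrality, a zero norm contradicts \<open>no_isotropic_pair\<close>. Once f is affine,
  \<open>class_unique\<close> and \<open>saturated\<close> pass from chosen points to all of
  \<open>S\<close>.\<close>

lemma affine_membership:
  obtains \<alpha> \<beta> where "\<And>x y. (x, y) \<in> S \<longleftrightarrow>
    x \<in> {0..<int (p^2)} \<and> y \<in> {0..<int (p^2)} \<and> [y = \<alpha> * (x - t * y) + \<beta>] (mod int p)"
proof -
  have "\<forall>c. \<exists>x y. (x, y) \<in> S \<and> [x - t * y = int c] (mod int p)"
    using class_exists by metis
  then obtain X f where Xf: "(X c, f c) \<in> S" "[X c - t * f c = int c] (mod int p)" for c
    by metis
  define M where "M = {m \<in> {0..<int p}. \<forall>s. [(1 + m * t)^2 + m^2 = s^2] (mod int p) \<longrightarrow> int p dvd s}"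
  have "c = c'" if m: "m \<in> M" and c: "c < p" "c' < p"
    and eq: "[f c - m * int c = f c' - m * int c'] (mod int p)" for m c c'
  proof -
    \<comment> \<open>A pair with slope m has difference \<delta> (1 + m t, m) modulo p; the aim is
      that \<delta> vanishes.\<close>
    define dx dy \<delta> where "dx = X c - X c'" and "dy = f c - f c'" and "\<delta> = int c - int c'"
    have diff: "[dx - t * dy = \<delta>] (mod int p)"
      using cong_diff[OF Xf(2)[of c] Xf(2)[of c']] by (simp add: dx_def dy_def \<delta>_def algebra_simps)
    have dy: "[dy = m * \<delta>] (mod int p)"
      using eq by (simp add: cong_iff_dvd_diff dy_def \<delta>_def algebra_simps)
    have "[(dx - t * dy) + t * dy = \<delta> + t * (m * \<delta>)] (mod int p)"
      by (intro cong_add cong_scalar_left diff dy)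
    then have dx: "[dx = (1 + m * t) * \<delta>] (mod int p)" by (simp add: algebra_simps)
    obtain s where "[dx^2 + dy^2 = s^2] (mod int (p^2))"
      using dist_square[OF Xf(1)[of c] Xf(1)[of c']] unfolding dx_def dy_def .
    then have s: "[dx^2 + dy^2 = s^2] (mod int p)" by (rule mod_p_if_mod_square)
    have "((1 + m * t)^2 + m^2) * \<delta>^2 = ((1 + m * t) * \<delta>)^2 + (m * \<delta>)^2"
      unfolding power_mult_distrib by (rule distrib_right)
    also have "[\<dots> = dx^2 + dy^2] (mod int p)"
      by (intro cong_add cong_pow cong_sym[OF dx] cong_sym[OF dy])
    also note s
    finally have sq: "[((1 + m * t)^2 + m^2) * \<delta>^2 = s^2] (mod int p)" .
    have "int p dvd \<delta>"
    proof (rule ccontr)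
      assume "\<not> int p dvd \<delta>"
      then obtain r where r: "[(1 + m * t)^2 + m^2 = r^2] (mod int p)" "int p dvd r \<longrightarrow> int p dvd s"
        by (rule square_factor[OF sq])
      \<comment> \<open>Membership of m in \<open>M\<close> makes r, hence s, vanish modulo p, so
        the pair is isotropic.\<close>
      then have "int p dvd s" using m by (auto simp: M_def)
      then have "int p dvd dx^2 + dy^2" using s by (simp add: cong_dvd_iff power2_eq_square)
      then have "int p dvd dx" "int p dvd dy"
        using no_isotropic_pair[OF Xf(1)[of c] Xf(1)[of c']] unfolding dx_def dy_def by blast+
      then have "int p dvd dx - t * dy" by simp
      then show False using diff \<open>\<not> int p dvd \<delta>\<close> by (simp add: cong_dvd_iff)
    qed
    then show "c = c'"
      using not_dvd_diff_residues[of "int c" "int p" "int c'"] c by (auto simp: \<delta>_def)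
  qed
  moreover have "odd p" using prime p3 prime_odd_nat[of p] by simp
  moreover have "M \<subseteq> {0..<int p}" by (auto simp: M_def)
  moreover have "(p - 1) div 2 \<le> card M"
    unfolding M_def using card_nonsquare_slopes[OF prime p3 nonsquare] .
  ultimately obtain \<alpha> \<beta> where ab: "\<And>c. c < p \<Longrightarrow> [f c = \<alpha> * int c + \<beta>] (mod int p)"
    using affine_if_few_directions[OF prime, of M f] by metis
  have rep: "\<exists>a b. (a, b) \<in> S \<and> [a - t * b = x - t * y] (mod int p) \<and>
      [b = \<alpha> * (x - t * y) + \<beta>] (mod int p)" for x y
  proof -
    define c where "c = nat ((x - t * y) mod int p)"
    have c: "c < p" "[int c = x - t * y] (mod int p)"
      using p3 by (auto simp: c_def nat_less_iff cong_def)
    have "[f c = \<alpha> * int c + \<beta>] (mod int p)" using ab c(1) .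
    also have "[\<alpha> * int c + \<beta> = \<alpha> * (x - t * y) + \<beta>] (mod int p)"
      by (intro cong_add cong_scalar_left c cong_refl)
    finally show ?thesis using Xf[of c] c(2) cong_trans by blast
  qed
  have "(x, y) \<in> S \<longleftrightarrow>
    x \<in> {0..<int (p^2)} \<and> y \<in> {0..<int (p^2)} \<and> [y = \<alpha> * (x - t * y) + \<beta>] (mod int p)" for x y
  proof -
    obtain a b where r: "(a, b) \<in> S" "[a - t * b = x - t * y] (mod int p)"
      "[b = \<alpha> * (x - t * y) + \<beta>] (mod int p)"
      using rep by blast
    show ?thesis
    proof
      assume S: "(x, y) \<in> S"
      have "[b = y] (mod int p)"
        using class_unique(2)[OF r(1) S r(2)] by (simp add: cong_iff_dvd_diff)
      then show "x \<in> {0..<int (p^2)} \<and> y \<in> {0..<int (p^2)} \<and> [y = \<alpha> * (x - t * y) + \<beta>] (mod int p)"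
        using in_range[OF S] r(3) by (metis cong_sym cong_trans)
    next
      assume *: "x \<in> {0..<int (p^2)} \<and> y \<in> {0..<int (p^2)} \<and> [y = \<alpha> * (x - t * y) + \<beta>] (mod int p)"
      then have y: "[y = b] (mod int p)" using r(3) by (metis cong_sym cong_trans)
      have "[(x - t * y) + t * y = (a - t * b) + t * b] (mod int p)"
        by (intro cong_add cong_scalar_left y cong_sym[OF r(2)])
      then have "int p dvd x - a" by (simp add: cong_iff_dvd_diff)
      then show "(x, y) \<in> S"
        using saturated[OF r(1)] * y by (simp add: cong_iff_dvd_diff)
    qed
  qed
  then show ?thesis by (rule that)
qed

text \<open>Modulo p the set is a line with direction (A, \<alpha>), and the form A y - \<alpha> x -
  \<beta> cutting it out serves as second coordinate of a similarity. The factor A^2 + \<alpha>^2 is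
  modulo p^2 a squared distance in \<open>S\<close>, hence a square, and a unit by
  \<open>no_isotropic_pair\<close>.\<close>

lemma isomorphic_set_a: "isomorphic_point_sets (Zmod (p^2)) S (set_a p)"
proof -
  obtain \<alpha> \<beta> where S: "\<And>x y. (x, y) \<in> S \<longleftrightarrow>
    x \<in> {0..<int (p^2)} \<and> y \<in> {0..<int (p^2)} \<and> [y = \<alpha> * (x - t * y) + \<beta>] (mod int p)"
    using affine_membership by blast
  define A where "A = 1 + \<alpha> * t"
  have S_iff: "(x, y) \<in> S \<longleftrightarrow> (x, y) \<in> plane (Zmod (p^2)) \<and> int p dvd A * y - \<alpha> * x + - \<beta>" for x y
    unfolding S plane_residue_ring
    by (simp add: A_def cong_iff_dvd_diff algebra_simps)
  have inS: "(x mod int (p^2), y mod int (p^2)) \<in> S" if "A * y - \<alpha> * x + - \<beta> = 0" for x y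
  proof -
    have "[A * (y mod int (p^2)) - \<alpha> * (x mod int (p^2)) + - \<beta> = A * y - \<alpha> * x + - \<beta>] (mod int (p^2))"
      by (intro cong_add cong_diff cong_scalar_left) (simp_all add: cong_def)
    then have "int p dvd A * (y mod int (p^2)) - \<alpha> * (x mod int (p^2)) + - \<beta>"
      using that mod_p_if_mod_square cong_0_iff by metis
    then show ?thesis using S_iff plane_residue_ring p3 by simp
  qed
  let ?r = "\<lambda>a. a mod int (p^2)"
  \<comment> \<open>These are the points of the integer line y = \<alpha> (x - t y) + \<beta> with x
    - t y equal to 0 and 1, reduced modulo p^2; they differ by (A, \<alpha>).\<close>
  have u0: "(?r (t * \<beta>), ?r \<beta>) \<in> S"
    by (intro inS) (simp add: A_def algebra_simps)
  have u1: "(?r (A + t * \<beta>), ?r (\<alpha> + \<beta>)) \<in> S"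
    by (intro inS) (simp add: A_def algebra_simps)
  have d: "[?r (A + t * \<beta>) - ?r (t * \<beta>) = A] (mod int (p^2))"
    "[?r (\<alpha> + \<beta>) - ?r \<beta> = \<alpha>] (mod int (p^2))"
    by (simp_all add: cong_def mod_simps)
  let ?N = "(?r (A + t * \<beta>) - ?r (t * \<beta>))^2 + (?r (\<alpha> + \<beta>) - ?r \<beta>)^2"
  have N: "[?N = A^2 + \<alpha>^2] (mod int (p^2))" by (intro cong_add cong_pow d)
  obtain s where "[?N = s^2] (mod int (p^2))" using dist_square[OF u1 u0] .
  then have s: "[A^2 + \<alpha>^2 = s^2] (mod int (p^2))" by (rule cong_trans[OF cong_sym[OF N]])
  have "\<not> int p dvd s"
  proof
    assume "int p dvd s"
    then have "int p dvd s^2" by (simp add: power2_eq_square)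
    then have "int p dvd ?N"
      using N s mod_p_if_mod_square by (metis cong_dvd_iff)
    from no_isotropic_pair[OF u1 u0 this] have "int p dvd A" "int p dvd \<alpha>"
      using d mod_p_if_mod_square by (metis cong_dvd_iff)+
    \<comment> \<open>By the choice of \<open>A\<close> this difference is 1.\<close>
    then have "int p dvd A - \<alpha> * t" by simp
    then show False using p3 by (simp add: A_def)
  qed
  then have cop: "coprime s (int (p^2))"
    using prime_imp_coprime[OF prime_int] by (simp add: coprime_commute)
  let ?\<phi> = "\<lambda>(x, y). (?r (A * x + \<alpha> * y + 0), ?r (A * y - \<alpha> * x + - \<beta>))"
  have aut: "plane_automorphism (Zmod (p^2)) ?\<phi>"
    using plane_automorphism_similarity[OF square_gt_1 s cop] .
  then have bij: "?\<phi> ` plane (Zmod (p^2)) = plane (Zmod (p^2))"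
    by (auto simp: plane_automorphism_def bij_betw_def)
  have "int p dvd ?r a \<longleftrightarrow> int p dvd a" for a
    by (simp add: dvd_mod_iff power2_eq_square)
  then have "S = {u \<in> plane (Zmod (p^2)). int p dvd snd (?\<phi> u)}"
    using S_iff by auto
  then have "?\<phi> ` S = {v \<in> ?\<phi> ` plane (Zmod (p^2)). int p dvd snd v}"
    by blast
  also have "\<dots> = set_a p"
    unfolding bij set_a_eq[OF prime] by auto
  finally show ?thesis using aut unfolding isomorphic_point_sets_def by blast
qed

end

theorem theorem8:
  fixes p :: nat
  assumes "prime p" and "p \<ge> 3"
  shows "max_integral_card (Zmod (p^2)) = p^3 \<and>
    (\<forall>S. integral_point_set (Zmod (p^2)) S \<and> card S = p^3 \<longrightarrow>
       isomorphic_point_sets (Zmod (p^2)) S (set_a p) \<or>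
       ((\<ominus>\<^bsub>Zmod p\<^esub> \<one>\<^bsub>Zmod p\<^esub>) \<in> ring_squares (Zmod p) \<and>
        minus_one_roots (Zmod (p^2)) \<noteq> {} \<and>
        (\<forall>\<omega> \<in> minus_one_roots (Zmod (p^2)).
           isomorphic_point_sets (Zmod (p^2)) S (set_b p \<omega>))) \<or>
       ((\<ominus>\<^bsub>Zmod p\<^esub> \<one>\<^bsub>Zmod p\<^esub>) \<in> ring_squares (Zmod p) \<and>
        minus_one_roots (Zmod p) \<noteq> {} \<and>
        (\<forall>\<omega>\<^sub>p \<in> minus_one_roots (Zmod p).
           isomorphic_point_sets (Zmod (p^2)) S (set_c p \<omega>\<^sub>p))))"
proof (intro conjI allI impI)
  \<comment> \<open>One t depending only on p serves all sets S.\<close>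
  obtain t :: int where t: "\<And>s. \<not> [1 + t^2 = s^2] (mod int p)"
    using ex_one_plus_square_nonsquare[OF assms(2)] by blast
  have le: "card S \<le> p^3" if "integral_point_set (Zmod (p^2)) S" for S
  proof -
    interpret integral_set_mod_prime_square p S t
      using assms that t by unfold_locales
    show ?thesis by (rule card_le)
  qed
  let ?C = "{card S | S. integral_point_set (Zmod (p^2)) S}"
  have bound: "n \<le> p^3" if "n \<in> ?C" for n
    using that le unfolding mem_Collect_eq by (elim exE conjE) (simp only:)
  show "max_integral_card (Zmod (p^2)) = p^3"
    unfolding max_integral_card_def
  proof (rule Max_eqI)
    show "finite ?C"
    proof (rule finite_subset)
      show "?C \<subseteq> {..p^3}" by (rule subsetI, rule atMost_iff[THEN iffD2], rule bound)
    qed simp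
    show "p^3 \<in> {card S | S. integral_point_set (Zmod (p^2)) S}"
      using integral_set_a[OF assms(1)] card_set_a[OF assms(1)]
      by (intro CollectI exI[of _ "set_a p"]) simp
  qed (rule bound)
  fix S assume "integral_point_set (Zmod (p^2)) S \<and> card S = p^3"
  then interpret maximum_integral_set_mod_prime_square p S t
    using assms t by unfold_locales auto
  show "isomorphic_point_sets (Zmod (p^2)) S (set_a p) \<or>
       ((\<ominus>\<^bsub>Zmod p\<^esub> \<one>\<^bsub>Zmod p\<^esub>) \<in> ring_squares (Zmod p) \<and>
        minus_one_roots (Zmod (p^2)) \<noteq> {} \<and>
        (\<forall>\<omega> \<in> minus_one_roots (Zmod (p^2)).
           isomorphic_point_sets (Zmod (p^2)) S (set_b p \<omega>))) \<or>
       ((\<ominus>\<^bsub>Zmod p\<^esub> \<one>\<^bsub>Zmod p\<^esub>) \<in> ring_squares (Zmod p) \<and>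
        minus_one_roots (Zmod p) \<noteq> {} \<and>
        (\<forall>\<omega>\<^sub>p \<in> minus_one_roots (Zmod p).
           isomorphic_point_sets (Zmod (p^2)) S (set_c p \<omega>\<^sub>p)))"
    using isomorphic_set_a ..
qed

end
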